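(* For any $p>0$, there exist integers $N,m>0$ and symmetric matrices $A_0,\dots,A_N\in S^m$ such that, for the LMI-representable set $K=\{x\in\mathbb{R}^N : A_0+x_1A_1+\dots+x_NA_N\in S^m_+\}$, the metric projection $\Pi_K:\mathbb{R}^N\to\mathbb{R}^N$ fails to be $p$-order semismooth (i.e., there is a point at which it is not $p$-order semismooth).
   Context: $S^m$ is the space of real symmetric $m\times m$ matrices and $S^m_+$ the cone of positive semidefinite ones. A set of the displayed form is called LMI-representable (a spectrahedron). $\mathbb{R}^N$ has the Euclidean inner product and $\Pi_K(x)$ is the nearest point of $K$ to $x$. For a locally Lipschitz $f$, the Clarke generalized Jacobian $\partial f(x)$ is the convex hull of all limits of Jacobians $f'(x_k)$ along sequences $x_k\to x$ of differentiability points. For $p>0$, $f$ is $p$-order semismooth at $x$ if it is directionally differentiable at $x$ and for any $V\in\partial f(x+h)$, $\|f(x+h)-f(x)-Vh\|=O(\|h\|^{1+p})$ as $h\to0$. *)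

theory Defs
  imports "HOL-Analysis.Analysis"
begin

text \<open>Conventions. The dimension N is existentially quantified in the statement, so
R^N is represented concretely: vectors are functions nat => real whose coordinates
0..N-1 are the entries (coordinates i >= N are zero); m x m matrices are functions
nat => nat => real whose entries with indices < m are the entries.\<close>

definition Rn :: "nat \<Rightarrow> (nat \<Rightarrow> real) set" where
  "Rn N = {x. \<forall>i\<ge>N. x i = 0}"

definition vnorm :: "nat \<Rightarrow> (nat \<Rightarrow> real) \<Rightarrow> real" where
  "vnorm N x = sqrt (\<Sum>i<N. (x i)\<^sup>2)"

definition vadd :: "(nat \<Rightarrow> real) \<Rightarrow> (nat \<Rightarrow> real) \<Rightarrow> (nat \<Rightarrow> real)" where
  "vadd x y = (\<lambda>i. x i + y i)"

definition vsub :: "(nat \<Rightarrow> real) \<Rightarrow> (nat \<Rightarrow> real) \<Rightarrow> (nat \<Rightarrow> real)" where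
  "vsub x y = (\<lambda>i. x i - y i)"

definition vscale :: "real \<Rightarrow> (nat \<Rightarrow> real) \<Rightarrow> (nat \<Rightarrow> real)" where
  "vscale t x = (\<lambda>i. t * x i)"

definition mv :: "nat \<Rightarrow> (nat \<Rightarrow> nat \<Rightarrow> real) \<Rightarrow> (nat \<Rightarrow> real) \<Rightarrow> (nat \<Rightarrow> real)" where
  "mv N J h = (\<lambda>i. if i < N then (\<Sum>j<N. J i j * h j) else 0)"

definition sym_mat :: "nat \<Rightarrow> (nat \<Rightarrow> nat \<Rightarrow> real) \<Rightarrow> bool" where
  "sym_mat m M \<longleftrightarrow> (\<forall>i<m. \<forall>j<m. M i j = M j i)"

definition psd :: "nat \<Rightarrow> (nat \<Rightarrow> nat \<Rightarrow> real) \<Rightarrow> bool" where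
  "psd m M \<longleftrightarrow> sym_mat m M \<and> (\<forall>v::nat \<Rightarrow> real. 0 \<le> (\<Sum>i<m. \<Sum>j<m. v i * M i j * v j))"

text \<open>The spectrahedron {x in R^N : A_0 + x_1 A_1 + ... + x_N A_N in S^m_+};
the coordinate x_k is stored as x (k-1).\<close>
definition spectrahedron ::
  "nat \<Rightarrow> nat \<Rightarrow> (nat \<Rightarrow> nat \<Rightarrow> nat \<Rightarrow> real) \<Rightarrow> (nat \<Rightarrow> real) set" where
  "spectrahedron N m A =
     {x \<in> Rn N. psd m (\<lambda>i j. A 0 i j + (\<Sum>k<N. x k * A (Suc k) i j))}"

definition proj :: "nat \<Rightarrow> (nat \<Rightarrow> real) set \<Rightarrow> (nat \<Rightarrow> real) \<Rightarrow> (nat \<Rightarrow> real)" where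
  "proj N K x = (THE y. y \<in> K \<and> (\<forall>z\<in>K. vnorm N (vsub x y) \<le> vnorm N (vsub x z)))"

definition has_jac ::
  "nat \<Rightarrow> ((nat \<Rightarrow> real) \<Rightarrow> (nat \<Rightarrow> real)) \<Rightarrow> (nat \<Rightarrow> real) \<Rightarrow> (nat \<Rightarrow> nat \<Rightarrow> real) \<Rightarrow> bool" where
  "has_jac N f x J \<longleftrightarrow>
     (\<forall>i j. (N \<le> i \<or> N \<le> j) \<longrightarrow> J i j = 0) \<and>
     (\<forall>\<epsilon>>0. \<exists>\<delta>>0. \<forall>h\<in>Rn N. vnorm N h < \<delta> \<longrightarrow>
        vnorm N (vsub (vsub (f (vadd x h)) (f x)) (mv N J h)) \<le> \<epsilon> * vnorm N h)"

definition bjac ::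
  "nat \<Rightarrow> ((nat \<Rightarrow> real) \<Rightarrow> (nat \<Rightarrow> real)) \<Rightarrow> (nat \<Rightarrow> real) \<Rightarrow> (nat \<Rightarrow> nat \<Rightarrow> real) set" where
  "bjac N f x = {J. \<exists>xs Js. (\<forall>k. xs k \<in> Rn N \<and> has_jac N f (xs k) (Js k)) \<and>
       (\<lambda>k. vnorm N (vsub (xs k) x)) \<longlonglongrightarrow> 0 \<and>
       (\<forall>i j. (\<lambda>k. Js k i j) \<longlonglongrightarrow> J i j)}"

definition clarke_jac ::
  "nat \<Rightarrow> ((nat \<Rightarrow> real) \<Rightarrow> (nat \<Rightarrow> real)) \<Rightarrow> (nat \<Rightarrow> real) \<Rightarrow> (nat \<Rightarrow> nat \<Rightarrow> real) set" where
  "clarke_jac N f x = {J. \<exists>(n::nat) (c::nat \<Rightarrow> real) (Bs::nat \<Rightarrow> nat \<Rightarrow> nat \<Rightarrow> real). (\<forall>l<n. 0 \<le> c l \<and> Bs l \<in> bjac N f x) \<and>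
       (\<Sum>l<n. c l) = 1 \<and> J = (\<lambda>i j. \<Sum>l<n. c l * Bs l i j)}"

definition dir_diff ::
  "nat \<Rightarrow> ((nat \<Rightarrow> real) \<Rightarrow> (nat \<Rightarrow> real)) \<Rightarrow> (nat \<Rightarrow> real) \<Rightarrow> bool" where
  "dir_diff N f x \<longleftrightarrow> (\<forall>d\<in>Rn N. \<exists>L::nat \<Rightarrow> real. \<forall>i<N.
       ((\<lambda>t. (f (vadd x (vscale t d)) i - f x i) / t) \<longlongrightarrow> L i) (at_right 0))"

definition semismooth ::
  "nat \<Rightarrow> real \<Rightarrow> ((nat \<Rightarrow> real) \<Rightarrow> (nat \<Rightarrow> real)) \<Rightarrow> (nat \<Rightarrow> real) \<Rightarrow> bool" where
  "semismooth N p f x \<longleftrightarrow> dir_diff N f x \<and>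
     (\<exists>C \<delta>. 0 < \<delta> \<and> (\<forall>h\<in>Rn N. vnorm N h < \<delta> \<longrightarrow>
        (\<forall>W\<in>clarke_jac N f (vadd x h).
           vnorm N (vsub (vsub (f (vadd x h)) (f x)) (mv N W h)) \<le> C * vnorm N h powr (1 + p))))"

end

theory Submission
  imports Defs
begin

text \<open>Put \<open>n = q + 1\<close> and let \<open>K\<close> be the cone of all \<open>z\<close> in \<open>R^(n+1)\<close> for which the \<open>q\<close> blocks
  \<open>[[z a, z (a+1)], [z (a+1), z (a+2)]]\<close> are positive semidefinite. Write \<open>d(r) = (1, r, ..., r^n)\<close> and
  read a vector \<open>w\<close> as a polynomial. If \<open>w\<close> has the double root \<open>r \<ge> 0\<close> and its quotient by the square of
  \<open>X - r\<close> has nonnegative coefficients, then \<open>w\<close> is nonnegative on \<open>K\<close> and orthogonal to \<open>d(r)\<close>, so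
  \<open>x d(r) - w\<close> projects to \<open>x d(r)\<close> for every \<open>x \<ge> 0\<close>. If the coefficients are positive and \<open>x > 0\<close>, this
  describes the projection \<open>f\<close> near \<open>u = x d(r) - w\<close>, with \<open>r\<close> an implicit function of \<open>u\<close>, and gives the
  Jacobian \<open>J\<close> of \<open>f\<close> at \<open>u\<close>.

  Semismoothness fails at \<open>u0 = - e_n\<close>, where \<open>f\<close> vanishes. Take \<open>x = r^(n-2)\<close> and let \<open>w\<close> be \<open>X^n\<close>
  minus its tangent at \<open>r\<close>; then \<open>h = u - u0\<close> has norm \<open>O(r^(n-2))\<close>. As \<open>f\<close> is positively homogeneous,
  \<open>J u = f(u)\<close>, so \<open>f(u) - f(u0) - J h = - J e_n\<close>, which has order \<open>r^(n-1)\<close>. This contradicts order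
  \<open>p\<close> as soon as \<open>(n - 2) (1 + p) > n - 1\<close>.\<close>

section \<open>The cone of vectors with positive semidefinite Hankel blocks\<close>

text \<open>Row \<open>i\<close> sits in block \<open>i div 2\<close> at position
  \<open>i mod 2\<close>. The index \<open>k\<close> is shifted by one because
  \<open>spectrahedron\<close> pairs coordinate \<open>k\<close> with matrix \<open>Suc k\<close>;
  matrix 0 vanishes, which makes the set a cone.\<close>

definition hankel_blocks :: "nat \<Rightarrow> nat \<Rightarrow> nat \<Rightarrow> real" where
  "hankel_blocks k i j =
     (if i div 2 = j div 2 \<and> k = Suc (i div 2 + i mod 2 + j mod 2) then 1 else 0)"

definition hankel_cone :: "nat \<Rightarrow> (nat \<Rightarrow> real) set" where
  "hankel_cone q = spectrahedron (Suc (Suc q)) (2 * q) hankel_blocks"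

definition ray :: "nat \<Rightarrow> real \<Rightarrow> real \<Rightarrow> (nat \<Rightarrow> real)" where
  "ray N x r = (\<lambda>i. if i < N then x * r ^ i else 0)"

lemma sym_hankel_blocks: "sym_mat m (hankel_blocks k)"
  by (auto simp: sym_mat_def hankel_blocks_def add_ac)

lemma sum_lessThan_double:
  fixes f :: "nat \<Rightarrow> real"
  shows "(\<Sum>i<2 * q. f i) = (\<Sum>a<q. f (2 * a) + f (2 * a + 1))"
  by (induction q) (auto simp: algebra_simps)

lemma hankel_blocks_pencil:
  assumes "i < 2 * q" "j < 2 * q"
  shows "hankel_blocks 0 i j + (\<Sum>k<Suc (Suc q). z k * hankel_blocks (Suc k) i j) =
    (if i div 2 = j div 2 then z (i div 2 + i mod 2 + j mod 2) else 0)"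
proof -
  have lt: "i div 2 + i mod 2 + j mod 2 < Suc (Suc q)"
    using assms by linarith
  show ?thesis
  proof (cases "i div 2 = j div 2")
    case True
    have "(\<Sum>k<Suc (Suc q). z k * hankel_blocks (Suc k) i j) =
        (\<Sum>k<Suc (Suc q). if k = i div 2 + i mod 2 + j mod 2 then z k else 0)"
      using True by (intro sum.cong) (auto simp: hankel_blocks_def)
    also have "\<dots> = z (i div 2 + i mod 2 + j mod 2)"
      using lt by (subst sum.delta) auto
    finally show ?thesis
      using True by (simp add: hankel_blocks_def)
  qed (simp add: hankel_blocks_def)
qed

lemma block_quadratic_form:
  fixes z v :: "nat \<Rightarrow> real"
  shows "(\<Sum>i<2 * q. \<Sum>j<2 * q. v i * (if i div 2 = j div 2 then z (i div 2 + i mod 2 + j mod 2) else 0) * v j)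
    = (\<Sum>a<q. z a * (v (2 * a))\<^sup>2 + 2 * z (a + 1) * v (2 * a) * v (2 * a + 1)
              + z (a + 2) * (v (2 * a + 1))\<^sup>2)" (is "?L = _")
proof -
  have inner: "(\<Sum>j<2 * q. c * (if a = j div 2 then g (j mod 2) else 0) * v j)
      = c * g 0 * v (2 * a) + c * g 1 * v (2 * a + 1)" if "a < q" for a :: nat and g c
  proof -
    have "(\<Sum>j<2 * q. c * (if a = j div 2 then g (j mod 2) else 0) * v j) =
       (\<Sum>b<q. if b = a then c * g 0 * v (2 * a) + c * g 1 * v (2 * a + 1) else 0)"
      by (subst sum_lessThan_double, intro sum.cong) auto
    then show ?thesis
      using that by simp
  qed
  have "?L = (\<Sum>a<q. (\<Sum>j<2 * q. v (2 * a) * (if a = j div 2 then z (a + j mod 2) else 0) * v j) +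
      (\<Sum>j<2 * q. v (2 * a + 1) * (if a = j div 2 then z (a + 1 + j mod 2) else 0) * v j))"
    by (rule trans[OF sum_lessThan_double]) (simp cong: if_cong)
  also have "\<dots> = (\<Sum>a<q. z a * (v (2 * a))\<^sup>2 + 2 * z (a + 1) * v (2 * a) * v (2 * a + 1)
              + z (a + 2) * (v (2 * a + 1))\<^sup>2)"
  proof (rule sum.cong[OF refl])
    fix a assume "a \<in> {..<q}"
    then have a: "a < q" by simp
    show "(\<Sum>j<2 * q. v (2 * a) * (if a = j div 2 then z (a + j mod 2) else 0) * v j) +
        (\<Sum>j<2 * q. v (2 * a + 1) * (if a = j div 2 then z (a + 1 + j mod 2) else 0) * v j)
      = z a * (v (2 * a))\<^sup>2 + 2 * z (a + 1) * v (2 * a) * v (2 * a + 1)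
              + z (a + 2) * (v (2 * a + 1))\<^sup>2"
      unfolding inner[OF a, of "v (2 * a)" "\<lambda>s. z (a + s)"]
        inner[OF a, of "v (2 * a + 1)" "\<lambda>s. z (a + 1 + s)"]
      by (simp add: power2_eq_square algebra_simps)
  qed
  finally show ?thesis .
qed

lemma mem_hankel_cone_iff:
  "z \<in> hankel_cone q \<longleftrightarrow> z \<in> Rn (Suc (Suc q)) \<and>
    (\<forall>v. 0 \<le> (\<Sum>a<q. z a * (v (2 * a))\<^sup>2 + 2 * z (a + 1) * v (2 * a) * v (2 * a + 1)
              + z (a + 2) * (v (2 * a + 1))\<^sup>2))"
proof -
  define B where "B = (\<lambda>i j. if i div 2 = j div 2 then z (i div 2 + i mod 2 + j mod 2) else 0)"
  define M where "M = (\<lambda>i j. hankel_blocks 0 i j + (\<Sum>k<Suc (Suc q). z k * hankel_blocks (Suc k) i j))"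
  have MB: "M i j = B i j" if "i < 2 * q" "j < 2 * q" for i j
    unfolding M_def B_def by (rule hankel_blocks_pencil[OF that])
  have "(\<Sum>i<2 * q. \<Sum>j<2 * q. v i * M i j * v j) =
      (\<Sum>i<2 * q. \<Sum>j<2 * q. v i * B i j * v j)" for v
    by (intro sum.cong) (auto simp: MB)
  moreover have "sym_mat (2 * q) M"
    by (auto simp: sym_mat_def MB) (auto simp: B_def add_ac)
  moreover have "z \<in> hankel_cone q \<longleftrightarrow> z \<in> Rn (Suc (Suc q)) \<and> psd (2 * q) M"
    by (simp add: hankel_cone_def spectrahedron_def M_def del: sum.lessThan_Suc)
  ultimately show ?thesis
    unfolding psd_def by (simp add: B_def block_quadratic_form)
qed

text \<open>Block \<open>a\<close> of \<open>x d(r)\<close> is \<open>x r^a\<close> times the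
  rank-one matrix of the vector \<open>(1, r)\<close>, so the form is a weighted sum of
  squares.\<close>

lemma ray_in_hankel_cone:
  assumes "0 \<le> x" "0 \<le> r"
  shows "ray (Suc (Suc q)) x r \<in> hankel_cone q"
proof -
  have "0 \<le> (\<Sum>a<q. x * r ^ a * (v (2 * a) + r * v (2 * a + 1))\<^sup>2)" for v :: "nat \<Rightarrow> real"
    using assms by (intro sum_nonneg) auto
  moreover have "(\<Sum>a<q. x * r ^ a * (v (2 * a) + r * v (2 * a + 1))\<^sup>2) =
     (\<Sum>a<q. ray (Suc (Suc q)) x r a * (v (2 * a))\<^sup>2
        + 2 * ray (Suc (Suc q)) x r (a + 1) * v (2 * a) * v (2 * a + 1)
        + ray (Suc (Suc q)) x r (a + 2) * (v (2 * a + 1))\<^sup>2)" for v :: "nat \<Rightarrow> real"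
    by (intro sum.cong) (auto simp: ray_def power2_eq_square algebra_simps)
  ultimately show ?thesis
    unfolding mem_hankel_cone_iff by (auto simp: Rn_def ray_def)
qed

section \<open>Pairing the cone with polynomials that have a double root\<close>

text \<open>The form is tested on the vector that is \<open>(r, -1)\<close> on block
  \<open>a\<close> and zero on the other blocks.\<close>

lemma hankel_cone_second_difference:
  assumes "z \<in> hankel_cone q" "a < q"
  shows "0 \<le> r\<^sup>2 * z a - 2 * r * z (a + 1) + z (a + 2)"
proof -
  define v where "v = (\<lambda>i. if i = 2 * a then r else if i = 2 * a + 1 then -1 else (0::real))"
  have "0 \<le> (\<Sum>b<q. z b * (v (2 * b))\<^sup>2 + 2 * z (b + 1) * v (2 * b) * v (2 * b + 1)
              + z (b + 2) * (v (2 * b + 1))\<^sup>2)"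
    using assms by (auto simp: mem_hankel_cone_iff)
  also have "\<dots> = (\<Sum>b<q. if b = a then r\<^sup>2 * z a - 2 * r * z (a + 1) + z (a + 2) else 0)"
    by (intro sum.cong) (auto simp: v_def dest: arg_cong[of _ _ even])
  finally show ?thesis
    using assms by simp
qed

text \<open>If \<open>w\<close> is read as the polynomial with coefficients \<open>w j\<close> and \<open>r\<close> is a double root of it, then
  \<open>quot N w r (i + 2)\<close> is the \<open>i\<close>-th coefficient of its quotient by the square of \<open>X - r\<close>, while
  the entries at \<open>0\<close> and \<open>1\<close> vanish.\<close>
definition quot :: "nat \<Rightarrow> (nat \<Rightarrow> real) \<Rightarrow> real \<Rightarrow> nat \<Rightarrow> real" where
  "quot N w r k = (\<Sum>j<N. real (Suc j - k) * r ^ (j - k) * w j)"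

text \<open>The weights \<open>(k + 1) r^k\<close> are the power series coefficients of
  \<open>1 / (1 - r X)^2\<close>, so convolution with \<open>(1 - r X)^2\<close> leaves a unit.
  Truncated subtraction gives weight zero for \<open>i < j\<close>.\<close>

lemma quot_recurrence:
  assumes "j < N"
  shows "w j = quot N w r j - 2 * r * quot N w r (j + 1) + r\<^sup>2 * quot N w r (j + 2)"
proof -
  have c: "real (Suc i - j) * r ^ (i - j) - 2 * r * (real (Suc i - (j + 1)) * r ^ (i - (j + 1)))
      + r\<^sup>2 * (real (Suc i - (j + 2)) * r ^ (i - (j + 2))) = (if i = j then 1 else 0)" for i
  proof -
    consider "i < j" | "i = j" | "i = j + 1" | s where "i = j + 2 + s"
      by (metis add_2_eq_Suc' add.commute less_imp_Suc_add linorder_neqE_nat not_less_eq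
          Suc_eq_plus1 add_Suc_right le_iff_add less_Suc_eq_le)
    then show ?thesis
      by cases (auto simp: power2_eq_square algebra_simps)
  qed
  have "quot N w r j - 2 * r * quot N w r (j + 1) + r\<^sup>2 * quot N w r (j + 2) =
    (\<Sum>i<N. (real (Suc i - j) * r ^ (i - j) - 2 * r * (real (Suc i - (j + 1)) * r ^ (i - (j + 1)))
      + r\<^sup>2 * (real (Suc i - (j + 2)) * r ^ (i - (j + 2)))) * w i)"
    unfolding quot_def by (simp add: sum_distrib_left sum.distrib sum_subtractf algebra_simps)
  also have "\<dots> = (\<Sum>i<N. if i = j then w i else 0)"
    unfolding c by (intro sum.cong) auto
  finally show ?thesis
    using assms by simp
qed

text \<open>Summation by parts moves the shifts of the recurrence from \<open>quot\<close> to
  \<open>z\<close>. The boundary terms vanish: at the bottom by the double root, at the top because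
  \<open>quot\<close> is zero from index \<open>q + 2\<close> on.\<close>

lemma sum_mult_eq_quot:
  assumes "(\<Sum>j<Suc (Suc q). w j * r ^ j) = 0"
    and "(\<Sum>j<Suc (Suc q). w j * (real j * r ^ (j - 1))) = 0"
  shows "(\<Sum>j<Suc (Suc q). w j * z j) =
    (\<Sum>a<q. quot (Suc (Suc q)) w r (a + 2) * (r\<^sup>2 * z a - 2 * r * z (a + 1) + z (a + 2)))"
proof -
  let ?N = "Suc (Suc q)"
  define L where "L = quot ?N w r"
  have 1: "L 1 = 0"
    using assms(2) by (simp add: L_def quot_def mult_ac del: sum.lessThan_Suc)
  \<comment> \<open>Reading \<open>w\<close> as a polynomial, \<open>L 1\<close> is its derivative
    at \<open>r\<close>, and \<open>L 0\<close> is its value plus \<open>r\<close> times that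
    derivative.\<close>
  have "L 0 = (\<Sum>j<?N. w j * r ^ j) + r * (\<Sum>j<?N. w j * (real j * r ^ (j - 1)))"
    unfolding L_def quot_def sum_distrib_left sum.distrib[symmetric]
  proof (intro sum.cong refl)
    fix j
    show "real (Suc j - 0) * r ^ (j - 0) * w j = w j * r ^ j + r * (w j * (real j * r ^ (j - 1)))"
      by (cases j) (auto simp: algebra_simps)
  qed
  then have 0: "L 0 = 0"
    using assms by simp
  have top: "L k = 0" if "k \<ge> ?N" for k
    unfolding L_def quot_def using that by (intro sum.neutral) auto
  have "(\<Sum>j<?N. w j * z j) = (\<Sum>j<?N. L j * z j) - (\<Sum>j<?N. L (j + 1) * (2 * r * z j))
      + (\<Sum>j<?N. L (j + 2) * (r\<^sup>2 * z j))"
    unfolding sum_subtractf[symmetric] sum.distrib[symmetric]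
  proof (intro sum.cong refl)
    fix j assume "j \<in> {..<?N}"
    then have "w j = L j - 2 * r * L (j + 1) + r\<^sup>2 * L (j + 2)"
      unfolding L_def by (intro quot_recurrence) simp
    then have "w j * z j = (L j - 2 * r * L (j + 1) + r\<^sup>2 * L (j + 2)) * z j"
      by simp
    then show "w j * z j = L j * z j - L (j + 1) * (2 * r * z j) + L (j + 2) * (r\<^sup>2 * z j)"
      by (simp add: algebra_simps)
  qed
  also have "(\<Sum>j<?N. L j * z j) = (\<Sum>a<q. L (a + 2) * z (a + 2))"
    using 0 1 by (simp add: sum.lessThan_Suc_shift del: sum.lessThan_Suc)
  also have "(\<Sum>j<?N. L (j + 1) * (2 * r * z j)) = (\<Sum>j<Suc q. L (j + 1) * (2 * r * z j))"
    using top[of "?N"] by simp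
  also have "\<dots> = (\<Sum>a<q. L (a + 2) * (2 * r * z (a + 1)))"
    using 1 by (simp add: sum.lessThan_Suc_shift del: sum.lessThan_Suc)
  also have "(\<Sum>j<?N. L (j + 2) * (r\<^sup>2 * z j)) = (\<Sum>a<q. L (a + 2) * (r\<^sup>2 * z a))"
    using top[of "?N"] top[of "Suc ?N"] by simp
  also have "(\<Sum>a<q. L (a + 2) * z (a + 2)) - (\<Sum>a<q. L (a + 2) * (2 * r * z (a + 1)))
      + (\<Sum>a<q. L (a + 2) * (r\<^sup>2 * z a))
     = (\<Sum>a<q. L (a + 2) * (r\<^sup>2 * z a - 2 * r * z (a + 1) + z (a + 2)))"
    by (simp add: sum_subtractf sum.distrib algebra_simps)
  finally show ?thesis
    unfolding L_def .
qed

section \<open>The polar criterion for the projection\<close>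

lemma vnorm_eq_L2_set: "vnorm N x = L2_set x {..<N}"
  by (simp add: vnorm_def L2_set_def)

lemma vnorm_nonneg: "0 \<le> vnorm N x"
  by (simp add: vnorm_eq_L2_set)

lemma abs_le_vnorm: "i < N \<Longrightarrow> \<bar>x i\<bar> \<le> vnorm N x"
  unfolding vnorm_def
  by (rule real_le_rsqrt) (simp add: member_le_sum[where f = "\<lambda>i. (x i)\<^sup>2"])

lemma vnorm_le_sum_abs: "vnorm N x \<le> (\<Sum>i<N. \<bar>x i\<bar>)"
  unfolding vnorm_eq_L2_set by (rule L2_set_le_sum_abs)

text \<open>Moreau's criterion: \<open>y - u\<close> is orthogonal to \<open>y\<close> and
  nonnegative on \<open>K\<close>. The resulting Pythagorean inequality yields minimality and also
  the uniqueness that the definite description in \<open>proj\<close> demands.\<close>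

lemma proj_eqI:
  assumes "y \<in> K" "K \<subseteq> Rn N"
    and orth: "(\<Sum>i<N. (y i - u i) * y i) = 0"
    and polar: "\<And>z. z \<in> K \<Longrightarrow> 0 \<le> (\<Sum>i<N. (y i - u i) * z i)"
  shows "proj N K u = y"
proof -
  have pyth: "(\<Sum>i<N. (u i - y i)\<^sup>2) + (\<Sum>i<N. (y i - z i)\<^sup>2) \<le> (\<Sum>i<N. (u i - z i)\<^sup>2)" if "z \<in> K" for z
  proof -
    have "(\<Sum>i<N. (u i - z i)\<^sup>2) = (\<Sum>i<N. (u i - y i)\<^sup>2) + (\<Sum>i<N. (y i - z i)\<^sup>2)
        + 2 * (\<Sum>i<N. (y i - u i) * z i) - 2 * (\<Sum>i<N. (y i - u i) * y i)"
      unfolding sum_distrib_left sum.distrib[symmetric] sum_subtractf[symmetric]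
      by (intro sum.cong) (auto simp: power2_eq_square algebra_simps)
    then show ?thesis
      using orth polar[OF that] by simp
  qed
  have le_iff: "vnorm N (vsub u a) \<le> vnorm N (vsub u b) \<longleftrightarrow>
      (\<Sum>i<N. (u i - a i)\<^sup>2) \<le> (\<Sum>i<N. (u i - b i)\<^sup>2)" for a b
    by (simp add: vnorm_def vsub_def)
  show ?thesis
    unfolding proj_def le_iff
  proof (intro the_equality conjI ballI)
    show "y \<in> K" by fact
  next
    fix z assume "z \<in> K"
    then show "(\<Sum>i<N. (u i - y i)\<^sup>2) \<le> (\<Sum>i<N. (u i - z i)\<^sup>2)"
      using pyth[of z] sum_nonneg[of "{..<N}" "\<lambda>i. (y i - z i)\<^sup>2"] by simp
  next
    fix y' assume y': "y' \<in> K \<and> (\<forall>z\<in>K. (\<Sum>i<N. (u i - y' i)\<^sup>2) \<le> (\<Sum>i<N. (u i - z i)\<^sup>2))"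
    then have "(\<Sum>i<N. (u i - y' i)\<^sup>2) \<le> (\<Sum>i<N. (u i - y i)\<^sup>2)"
      using \<open>y \<in> K\<close> by blast
    with pyth[of y'] y' have "(\<Sum>i<N. (y i - y' i)\<^sup>2) \<le> 0"
      by fastforce
    then have "(\<Sum>i<N. (y i - y' i)\<^sup>2) = 0"
      by (intro antisym sum_nonneg) auto
    then have "y i = y' i" if "i < N" for i
      using that by (subst (asm) sum_nonneg_eq_0_iff) auto
    moreover have "y i = y' i" if "i \<ge> N" for i
      using that subsetD[OF assms(2,1)] subsetD[OF assms(2), of y'] y' by (simp add: Rn_def)
    ultimately show "y' = y"
      by (metis ext not_le)
  qed
qed

text \<open>The residual is \<open>w\<close>. Its root at \<open>r\<close> gives orthogonality, and
  the double root turns its pairing with the cone into a sum of products of nonnegative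
  numbers.\<close>

lemma proj_hankel_cone:
  assumes "0 \<le> x" "0 \<le> r"
    and w: "\<And>j. j < Suc (Suc q) \<Longrightarrow> u j = x * r ^ j - w j"
    and root: "(\<Sum>j<Suc (Suc q). w j * r ^ j) = 0"
    and root': "(\<Sum>j<Suc (Suc q). w j * (real j * r ^ (j - 1))) = 0"
    and nonneg: "\<And>a. a < q \<Longrightarrow> 0 \<le> quot (Suc (Suc q)) w r (a + 2)"
  shows "proj (Suc (Suc q)) (hankel_cone q) u = ray (Suc (Suc q)) x r"
proof (rule proj_eqI)
  let ?N = "Suc (Suc q)"
  have w': "(\<Sum>i<?N. (ray ?N x r i - u i) * z i) = (\<Sum>i<?N. w i * z i)" for z
    using w by (intro sum.cong) (auto simp: ray_def)
  show "ray ?N x r \<in> hankel_cone q"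
    by (rule ray_in_hankel_cone) fact+
  show "hankel_cone q \<subseteq> Rn ?N"
    by (auto simp: mem_hankel_cone_iff)
  have "(\<Sum>i<?N. w i * ray ?N x r i) = x * (\<Sum>j<?N. w j * r ^ j)"
    unfolding sum_distrib_left by (intro sum.cong) (auto simp: ray_def)
  then show "(\<Sum>i<?N. (ray ?N x r i - u i) * ray ?N x r i) = 0"
    unfolding w' root by simp
  fix z assume "z \<in> hankel_cone q"
  then show "0 \<le> (\<Sum>i<?N. (ray ?N x r i - u i) * z i)"
    unfolding w' sum_mult_eq_quot[OF root root']
    by (intro sum_nonneg mult_nonneg_nonneg nonneg hankel_cone_second_difference) auto
qed

section \<open>Jacobians from an exact formula for the increment\<close>

text \<open>This filter encodes \<open>h\<close> tending to 0 within \<open>Rn N\<close>, so that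
  limit rules can replace the \<delta> quantifiers of \<open>has_jac\<close>.\<close>

definition small_vectors :: "nat \<Rightarrow> (nat \<Rightarrow> real) filter" where
  "small_vectors N = inf (filtercomap (vnorm N) (nhds 0)) (principal (Rn N))"

lemma eventually_small_vectors:
  "eventually P (small_vectors N) \<longleftrightarrow> (\<exists>\<delta>>0. \<forall>h\<in>Rn N. vnorm N h < \<delta> \<longrightarrow> P h)"
proof -
  have "eventually P (small_vectors N) \<longleftrightarrow>
      (\<exists>Q. (\<exists>d>0. \<forall>y. \<bar>y\<bar> < d \<longrightarrow> Q y) \<and> (\<forall>h. Q (vnorm N h) \<longrightarrow> h \<in> Rn N \<longrightarrow> P h))"
    by (simp add: small_vectors_def eventually_inf_principal eventually_filtercomap
        eventually_nhds_metric dist_real_def)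
  also have "\<dots> \<longleftrightarrow> (\<exists>\<delta>>0. \<forall>h\<in>Rn N. vnorm N h < \<delta> \<longrightarrow> P h)" (is "?A \<longleftrightarrow> ?B")
  proof
    assume ?A
    then obtain Q d where *: "d > 0" "\<forall>y. \<bar>y\<bar> < d \<longrightarrow> Q y" "\<forall>h. Q (vnorm N h) \<longrightarrow> h \<in> Rn N \<longrightarrow> P h"
      by blast
    then show ?B
      by (intro exI[of _ d]) (auto simp: vnorm_nonneg)
  next
    assume ?B
    then obtain d where *: "d > 0" "\<forall>h\<in>Rn N. vnorm N h < d \<longrightarrow> P h"
      by blast
    then show ?A
      by (intro exI[of _ "\<lambda>y. \<bar>y\<bar> < d"]) (auto simp: vnorm_nonneg)
  qed
  finally show ?thesis .
qed

lemma tendsto_small_vectors: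
  assumes "j < N"
  shows "((\<lambda>h. h j) \<longlongrightarrow> 0) (small_vectors N)"
proof (rule tendstoI)
  fix e :: real assume "e > 0"
  then show "\<forall>\<^sub>F h in small_vectors N. dist (h j) 0 < e"
    unfolding eventually_small_vectors
    using abs_le_vnorm[OF assms] by (auto intro!: exI[of _ e] intro: le_less_trans)
qed

text \<open>Caratheodory's form of differentiability: the increment is exactly linear in
  \<open>h\<close> with a matrix that tends to its value at \<open>r\<close>. The parameter \<rho>
  may depend on \<open>h\<close> in any way as long as it approaches \<open>r\<close>, so it need
  not come from a smooth implicit function.\<close>

lemma has_jac_caratheodory:
  fixes r :: real
  assumes cont: "\<And>i j. i < N \<Longrightarrow> j < N \<Longrightarrow> isCont (\<Gamma> i j) r"
    and incr: "\<And>\<eta>. \<eta> > 0 \<Longrightarrow> \<forall>\<^sub>F h in small_vectors N. \<exists>\<rho>. \<bar>\<rho> - r\<bar> < \<eta> \<and>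
      (\<forall>i<N. f (vadd u h) i - f u i = (\<Sum>j<N. \<Gamma> i j \<rho> * h j))"
  shows "has_jac N f u (\<lambda>i j. if i < N \<and> j < N then \<Gamma> i j r else 0)" (is "has_jac N f u ?J")
  unfolding has_jac_def
proof (intro conjI allI impI)
  fix \<epsilon> :: real assume "\<epsilon> > 0"
  \<comment> \<open>Each of the \<open>N * N\<close> matrix entries adds at most this multiple of
    \<open>vnorm N h\<close>; the summand 1 keeps the denominator positive.\<close>
  define \<epsilon>' where "\<epsilon>' = \<epsilon> / (1 + real N * real N)"
  have \<epsilon>': "\<epsilon>' > 0" "real N * real N * \<epsilon>' \<le> \<epsilon>"
    using \<open>\<epsilon> > 0\<close> by (auto simp: \<epsilon>'_def field_simps add_pos_nonneg)
  have "\<forall>\<^sub>F \<rho> in nhds r. \<forall>i\<in>{..<N}. \<forall>j\<in>{..<N}. dist (\<Gamma> i j \<rho>) (\<Gamma> i j r) < \<epsilon>'"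
    using cont \<epsilon>'(1)
    by (intro eventually_ball_finite ballI tendstoD)
      (auto simp: isCont_def tendsto_at_iff_tendsto_nhds)
  then obtain \<eta> where \<eta>: "\<eta> > 0"
    "\<And>\<rho> i j. \<bar>\<rho> - r\<bar> < \<eta> \<Longrightarrow> i < N \<Longrightarrow> j < N \<Longrightarrow> \<bar>\<Gamma> i j \<rho> - \<Gamma> i j r\<bar> < \<epsilon>'"
    by (auto simp: eventually_nhds_metric dist_real_def)
  obtain \<delta> where \<delta>: "\<delta> > 0" "\<And>h. h \<in> Rn N \<Longrightarrow> vnorm N h < \<delta> \<Longrightarrow> \<exists>\<rho>. \<bar>\<rho> - r\<bar> < \<eta> \<and>
      (\<forall>i<N. f (vadd u h) i - f u i = (\<Sum>j<N. \<Gamma> i j \<rho> * h j))"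
    using incr[OF \<eta>(1)] unfolding eventually_small_vectors by blast
  show "\<exists>\<delta>>0. \<forall>h\<in>Rn N. vnorm N h < \<delta> \<longrightarrow>
      vnorm N (vsub (vsub (f (vadd u h)) (f u)) (mv N ?J h)) \<le> \<epsilon> * vnorm N h"
  proof (intro exI[of _ \<delta>] conjI ballI impI \<delta>(1))
    fix h assume "h \<in> Rn N" "vnorm N h < \<delta>"
    then obtain \<rho> where \<rho>: "\<bar>\<rho> - r\<bar> < \<eta>"
      "\<And>i. i < N \<Longrightarrow> f (vadd u h) i - f u i = (\<Sum>j<N. \<Gamma> i j \<rho> * h j)"
      using \<delta>(2) by blast
    have comp: "\<bar>vsub (vsub (f (vadd u h)) (f u)) (mv N ?J h) i\<bar> \<le> real N * (\<epsilon>' * vnorm N h)"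
      if "i < N" for i
    proof -
      have "vsub (vsub (f (vadd u h)) (f u)) (mv N ?J h) i = (\<Sum>j<N. (\<Gamma> i j \<rho> - \<Gamma> i j r) * h j)"
        using that by (simp add: vsub_def mv_def \<rho>(2) left_diff_distrib sum_subtractf)
      also have "\<bar>\<dots>\<bar> \<le> (\<Sum>j<N. \<bar>(\<Gamma> i j \<rho> - \<Gamma> i j r) * h j\<bar>)"
        by (rule sum_abs)
      also have "\<dots> \<le> (\<Sum>j<N. \<epsilon>' * vnorm N h)"
        using less_imp_le[OF \<eta>(2)[OF \<rho>(1) that]] abs_le_vnorm[of _ N h] \<epsilon>'(1)
        by (intro sum_mono) (auto simp: abs_mult intro!: mult_mono)
      finally show ?thesis
        by simp
    qed
    have "vnorm N (vsub (vsub (f (vadd u h)) (f u)) (mv N ?J h)) \<le> (\<Sum>i<N. real N * (\<epsilon>' * vnorm N h))"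
      using comp by (intro order_trans[OF vnorm_le_sum_abs] sum_mono) auto
    also have "\<dots> = real N * real N * \<epsilon>' * vnorm N h"
      by simp
    also have "\<dots> \<le> \<epsilon> * vnorm N h"
      using \<epsilon>'(2) by (intro mult_right_mono vnorm_nonneg)
    finally show "vnorm N (vsub (vsub (f (vadd u h)) (f u)) (mv N ?J h)) \<le> \<epsilon> * vnorm N h" .
  qed
qed auto

section \<open>The critical equation for the nearest ray\<close>

text \<open>\<open>pow1 i\<close> and \<open>pow2 i\<close> are the first two derivatives of the
  \<open>i\<close>-th power; where an exponent is truncated, the factor in front is zero.\<close>

definition pow1 :: "nat \<Rightarrow> real \<Rightarrow> real" where
  "pow1 i \<rho> = real i * \<rho> ^ (i - 1)"

definition pow2 :: "nat \<Rightarrow> real \<Rightarrow> real" where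
  "pow2 i \<rho> = real i * real (i - 1) * \<rho> ^ (i - 2)"

text \<open>In terms of the curve \<open>d\<close>, \<open>sq_sum\<close> is \<open>|d|^2\<close>,
  \<open>cross_sum\<close> is \<open><d', d>\<close>, and \<open>cross_sum'\<close> is the
  derivative \<open><d'', d> + |d'|^2\<close> of the latter.\<close>

definition sq_sum :: "nat \<Rightarrow> real \<Rightarrow> real" where
  "sq_sum N \<rho> = (\<Sum>i<N. \<rho> ^ i * \<rho> ^ i)"

definition cross_sum :: "nat \<Rightarrow> real \<Rightarrow> real" where
  "cross_sum N \<rho> = (\<Sum>i<N. pow1 i \<rho> * \<rho> ^ i)"

definition cross_sum' :: "nat \<Rightarrow> real \<Rightarrow> real" where
  "cross_sum' N \<rho> = (\<Sum>i<N. pow2 i \<rho> * \<rho> ^ i + pow1 i \<rho> * pow1 i \<rho>)"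

text \<open>The ray through \<open>d(\<rho>)\<close> nearest to \<open>u\<close> maximises the normalised inner product of \<open>u\<close> and \<open>d(\<rho>)\<close>;
  clearing denominators, its critical points are the zeros of \<open>\<Sum>j<N. u j * crit N j \<rho>\<close>.\<close>
definition crit :: "nat \<Rightarrow> nat \<Rightarrow> real \<Rightarrow> real" where
  "crit N j \<rho> = \<rho> ^ j * cross_sum N \<rho> - pow1 j \<rho> * sq_sum N \<rho>"

definition crit' :: "nat \<Rightarrow> nat \<Rightarrow> real \<Rightarrow> real" where
  "crit' N j \<rho> = \<rho> ^ j * cross_sum' N \<rho> - pow1 j \<rho> * cross_sum N \<rho> - pow2 j \<rho> * sq_sum N \<rho>"

lemma DERIV_power_pow1: "((\<lambda>\<rho>. \<rho> ^ i) has_real_derivative pow1 i \<rho>) (at \<rho>)"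
  unfolding pow1_def by (auto intro!: derivative_eq_intros)

lemma DERIV_pow1: "(pow1 i has_real_derivative pow2 i \<rho>) (at \<rho>)"
  unfolding pow1_def[abs_def] pow2_def by (auto intro!: derivative_eq_intros simp: numeral_2_eq_2)

lemma DERIV_sq_sum: "(sq_sum N has_real_derivative 2 * cross_sum N \<rho>) (at \<rho>)"
  unfolding sq_sum_def[abs_def] cross_sum_def sum_distrib_left
  by (intro DERIV_sum DERIV_cong[OF DERIV_mult[OF DERIV_power_pow1 DERIV_power_pow1]]) simp

lemma DERIV_cross_sum: "(cross_sum N has_real_derivative cross_sum' N \<rho>) (at \<rho>)"
  unfolding cross_sum_def[abs_def] cross_sum'_def
  by (intro DERIV_sum DERIV_cong[OF DERIV_mult[OF DERIV_pow1 DERIV_power_pow1]]) simp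

lemma DERIV_crit: "(crit N j has_real_derivative crit' N j \<rho>) (at \<rho>)"
  unfolding crit_def[abs_def] crit'_def
  by (rule DERIV_cong[OF DERIV_diff[OF DERIV_mult[OF DERIV_power_pow1 DERIV_cross_sum]
          DERIV_mult[OF DERIV_pow1 DERIV_sq_sum]]])
    (simp add: algebra_simps)

lemma isCont_crit: "isCont (crit N j) \<rho>"
  by (rule DERIV_isCont[OF DERIV_crit])

lemma isCont_sq_sum: "isCont (sq_sum N) \<rho>"
  by (rule DERIV_isCont[OF DERIV_sq_sum])

lemma sq_sum_pos: "0 < sq_sum (Suc N) \<rho>"
proof -
  have "1 \<le> sq_sum (Suc N) \<rho>"
    unfolding sq_sum_def
    by (subst sum.lessThan_Suc_shift) (auto intro!: sum_nonneg)
  then show ?thesis by simp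
qed

section \<open>The Jacobian of the projection\<close>

text \<open>The first term of the Jacobian is the orthogonal projection onto the line of
  \<open>d(r)\<close>; the second accounts for the motion of the root \<open>r\<close>. Since
  \<open>e'\<close> is positive, \<open>r\<close> is a simple root of the critical equation and
  persists under perturbation of \<open>u\<close>.\<close>

lemma has_jac_proj_hankel_cone:
  assumes N: "N = Suc (Suc q)" and x: "0 < x" and r: "0 < r"
    and u: "\<And>j. j < N \<Longrightarrow> u j = x * r ^ j - w j"
    and root: "(\<Sum>j<N. w j * r ^ j) = 0"
    and root': "(\<Sum>j<N. w j * pow1 j r) = 0"
    and pos: "\<And>a. a < q \<Longrightarrow> 0 < quot N w r (a + 2)"
    and e': "e' = (\<Sum>j<N. u j * crit' N j r)" "0 < e'"
  shows "has_jac N (proj N (hankel_cone q)) u (\<lambda>i j. if i < N \<and> j < N then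
      r ^ (i + j) / sq_sum N r
        - (pow1 i r * x - r ^ i * x * cross_sum N r / sq_sum N r) * crit N j r / e' else 0)"
    and "proj N (hankel_cone q) u = ray N x r"
    and "(\<Sum>j<N. u j * r ^ j) = x * sq_sum N r"
    and "(\<Sum>j<N. u j * crit N j r) = 0"
proof -
  let ?f = "proj N (hankel_cone q)"
  define D where "D = sq_sum N"
  define e where "e = (\<lambda>\<rho>. \<Sum>j<N. u j * crit N j \<rho>)"
  define P where "P = (\<lambda>\<rho>. \<Sum>j<N. u j * \<rho> ^ j)"
  \<comment> \<open>This is coordinate \<open>i\<close> of the orthogonal projection of
    \<open>u\<close> onto the line of \<open>d(\<rho>)\<close>; \<open>\<psi>'\<close> is its
    derivative at \<open>r\<close>.\<close>
  define \<psi> where "\<psi> = (\<lambda>i \<rho>. \<rho> ^ i * P \<rho> / D \<rho>)"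
  define \<psi>' where "\<psi>' = (\<lambda>i. pow1 i r * x - r ^ i * x * cross_sum N r / D r)"
  have D: "0 < D \<rho>" for \<rho>
    unfolding D_def N by (rule sq_sum_pos)
  have D_cont: "isCont D \<rho>" for \<rho>
    unfolding D_def by (rule isCont_sq_sum)
  have fu: "?f u = ray N x r"
    by (rule proj_hankel_cone[where q = q, folded N, OF less_imp_le[OF x] less_imp_le[OF r] u root
          root'[unfolded pow1_def] less_imp_le[OF pos]])
  have crit_sum: "(\<Sum>j<N. v j * crit N j \<rho>) =
      (\<Sum>j<N. v j * \<rho> ^ j) * cross_sum N \<rho> - (\<Sum>j<N. v j * pow1 j \<rho>) * D \<rho>" for v \<rho>
    unfolding sum_distrib_right sum_subtractf[symmetric] D_def
    by (intro sum.cong) (auto simp: crit_def algebra_simps)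
  have Pr: "P r = x * D r"
  proof -
    have "P r = (\<Sum>j<N. x * (r ^ j * r ^ j) - w j * r ^ j)"
      unfolding P_def by (intro sum.cong) (auto simp: u algebra_simps)
    then show ?thesis
      by (simp add: sum_subtractf root D_def sq_sum_def sum_distrib_left)
  qed
  have P'r: "(\<Sum>j<N. u j * pow1 j r) = x * cross_sum N r"
  proof -
    have "(\<Sum>j<N. u j * pow1 j r) = (\<Sum>j<N. x * (pow1 j r * r ^ j) - w j * pow1 j r)"
      by (intro sum.cong) (auto simp: u algebra_simps)
    then show ?thesis
      by (simp add: sum_subtractf root' cross_sum_def sum_distrib_left)
  qed
  have er: "e r = 0"
    using Pr P'r unfolding e_def crit_sum P_def by (simp add: mult_ac)
  have e_deriv: "(e has_real_derivative e') (at r)"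
    unfolding e_def e'(1) by (intro DERIV_sum DERIV_cmult DERIV_crit)
  have P_deriv: "(P has_real_derivative x * cross_sum N r) (at r)"
    unfolding P_def P'r[symmetric] by (intro DERIV_sum DERIV_cmult DERIV_power_pow1)
  have \<psi>_deriv: "(\<psi> i has_real_derivative \<psi>' i) (at r)" for i
    unfolding \<psi>_def
    by (rule DERIV_cong[OF DERIV_divide[OF DERIV_mult[OF DERIV_power_pow1 P_deriv]
            DERIV_sq_sum[of N, folded D_def]]])
      (use D[of r] in \<open>auto simp: \<psi>'_def Pr field_simps\<close>)
  obtain e1 where e1: "\<And>\<rho>. e \<rho> - e r = e1 \<rho> * (\<rho> - r)" "isCont e1 r" "e1 r = e'"
    using e_deriv unfolding CARAT_DERIV by blast
  obtain s where s: "\<And>i \<rho>. \<psi> i \<rho> - \<psi> i r = s i \<rho> * (\<rho> - r)" "\<And>i. isCont (s i) r" "\<And>i. s i r = \<psi>' i"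
    using \<psi>_deriv unfolding CARAT_DERIV by metis
  \<comment> \<open>The increment of \<open>\<psi> i\<close> is
    \<open>s i \<rho> * (\<rho> - r)\<close>, and the critical equation for \<open>u + h\<close>
    expresses \<open>\<rho> - r\<close> linearly in \<open>h\<close> with denominator
    \<open>e1 \<rho>\<close>.\<close>
  define \<Gamma> where "\<Gamma> = (\<lambda>i j \<rho>. \<rho> ^ (i + j) / D \<rho> - s i \<rho> * crit N j \<rho> / e1 \<rho>)"
  have \<Gamma>_cont: "isCont (\<Gamma> i j) r" for i j
    unfolding \<Gamma>_def using D[of r] e1 e'(2) s(2) D_cont isCont_crit
    by (intro continuous_intros) auto
  \<comment> \<open>\<open>X h \<rho>\<close> is the coefficient of the projection of
    \<open>u + h\<close> onto the line of \<open>d(\<rho>)\<close>, and \<open>w'\<close> is the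
    residual.\<close>
  define X where "X = (\<lambda>h \<rho>. (\<Sum>j<N. (u j + h j) * \<rho> ^ j) / D \<rho>)"
  define w' where "w' = (\<lambda>h \<rho> j. X h \<rho> * \<rho> ^ j - (u j + h j))"
  \<comment> \<open>Here \<open>h\<close> and \<rho> vary independently, so the strict inequalities
    are secured before \<rho> is chosen as a root.\<close>
  let ?G = "small_vectors N \<times>\<^sub>F nhds r"
  have snd_lim: "(snd \<longlongrightarrow> r) ?G"
    by (rule filterlim_snd)
  have fst_lim: "((\<lambda>z. fst z j) \<longlongrightarrow> 0) ?G" if "j < N" for j
    using filterlim_compose[OF tendsto_small_vectors[OF that] filterlim_fst] .
  have D_lim: "((\<lambda>z. D (snd z)) \<longlongrightarrow> D r) ?G"
    by (rule isCont_tendsto_compose[OF D_cont snd_lim])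
  have "((\<lambda>z. X (fst z) (snd z)) \<longlongrightarrow> (\<Sum>j<N. (u j + 0) * r ^ j) / D r) ?G"
    unfolding X_def using D[of r] by (intro tendsto_intros fst_lim snd_lim D_lim) auto
  then have X_lim: "((\<lambda>z. X (fst z) (snd z)) \<longlongrightarrow> x) ?G"
    using Pr D[of r] by (simp add: P_def)
  have w'_lim: "((\<lambda>z. w' (fst z) (snd z) j) \<longlongrightarrow> w j) ?G" if "j < N" for j
  proof -
    have "((\<lambda>z. w' (fst z) (snd z) j) \<longlongrightarrow> x * r ^ j - (u j + 0)) ?G"
      unfolding w'_def by (intro tendsto_intros X_lim snd_lim fst_lim that)
    then show ?thesis
      using u[OF that] by simp
  qed
  have quot_lim: "((\<lambda>z. quot N (w' (fst z) (snd z)) (snd z) k) \<longlongrightarrow> quot N w r k) ?G" for k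
    unfolding quot_def by (intro tendsto_intros w'_lim snd_lim) auto
  have "\<forall>\<^sub>F z in ?G. \<forall>a\<in>{..<q}. 0 < quot N (w' (fst z) (snd z)) (snd z) (a + 2)"
    using pos by (intro eventually_ball_finite ballI order_tendstoD(1)[OF quot_lim]) auto
  moreover have "\<forall>\<^sub>F z in ?G. 0 < e1 (snd z)"
    using e1(3) e'(2) by (intro order_tendstoD(1)[OF isCont_tendsto_compose[OF e1(2) snd_lim]]) simp
  ultimately have "\<forall>\<^sub>F z in ?G. 0 < X (fst z) (snd z) \<and> 0 < snd z \<and> 0 < e1 (snd z) \<and>
      (\<forall>a\<in>{..<q}. 0 < quot N (w' (fst z) (snd z)) (snd z) (a + 2))"
    using order_tendstoD(1)[OF X_lim x] order_tendstoD(1)[OF snd_lim r] by eventually_elim auto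
  then obtain Ph Pr' where ev: "eventually Ph (small_vectors N)" "eventually Pr' (nhds r)"
    and good: "\<And>h \<rho>. Ph h \<Longrightarrow> Pr' \<rho> \<Longrightarrow> 0 < X h \<rho> \<and> 0 < \<rho> \<and> 0 < e1 \<rho> \<and>
      (\<forall>a<q. 0 < quot N (w' h \<rho>) \<rho> (a + 2))"
    unfolding eventually_prod_filter by auto
  have incr: "?f (vadd u h) i - ?f u i = (\<Sum>j<N. \<Gamma> i j \<rho> * h j)"
    if h: "Ph h" and \<rho>: "Pr' \<rho>" and crit0: "(\<Sum>j<N. (u j + h j) * crit N j \<rho>) = 0" and "i < N"
    for h \<rho> i
  proof -
    note g = good[OF h \<rho>]
    have XD: "X h \<rho> * D \<rho> = (\<Sum>j<N. (u j + h j) * \<rho> ^ j)"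
      using D[of \<rho>] by (simp add: X_def)
    have w'_sum: "(\<Sum>j<N. w' h \<rho> j * c j) = X h \<rho> * (\<Sum>j<N. c j * \<rho> ^ j) - (\<Sum>j<N. (u j + h j) * c j)" for c
      unfolding sum_distrib_left sum_subtractf[symmetric] w'_def
      by (intro sum.cong) (auto simp: algebra_simps)
    have r0: "(\<Sum>j<N. w' h \<rho> j * \<rho> ^ j) = 0"
      unfolding w'_sum XD[symmetric] by (simp add: D_def sq_sum_def)
    \<comment> \<open>The choice of \<open>X\<close> makes \<rho> a root of the residual; the
      critical equation makes it a double root.\<close>
    have "(\<Sum>j<N. (u j + h j) * pow1 j \<rho>) * D \<rho> = X h \<rho> * cross_sum N \<rho> * D \<rho>"
      using crit0 unfolding crit_sum XD[symmetric] by (auto simp: mult_ac)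
    then have r1: "(\<Sum>j<N. w' h \<rho> j * pow1 j \<rho>) = 0"
      unfolding w'_sum using D[of \<rho>] by (simp add: cross_sum_def)
    have "?f (vadd u h) = ray N (X h \<rho>) \<rho>"
      using g
      by (intro proj_hankel_cone[where q = q, folded N, OF _ _ _ r0 r1[unfolded pow1_def]])
        (auto simp: vadd_def w'_def less_imp_le)
    then have "?f (vadd u h) i - ?f u i = X h \<rho> * \<rho> ^ i - x * r ^ i"
      using \<open>i < N\<close> by (simp add: fu ray_def)
    also have "X h \<rho> * \<rho> ^ i = \<psi> i \<rho> + (\<Sum>j<N. \<rho> ^ (i + j) / D \<rho> * h j)"
    proof -
      have "X h \<rho> = P \<rho> / D \<rho> + (\<Sum>j<N. h j * \<rho> ^ j) / D \<rho>"
        unfolding X_def P_def by (simp add: distrib_right sum.distrib add_divide_distrib)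
      moreover have "\<rho> ^ i * ((\<Sum>j<N. h j * \<rho> ^ j) / D \<rho>) = (\<Sum>j<N. \<rho> ^ (i + j) / D \<rho> * h j)"
        unfolding sum_divide_distrib sum_distrib_left
        by (intro sum.cong) (auto simp: power_add)
      ultimately show ?thesis
        unfolding \<psi>_def by (simp add: algebra_simps)
    qed
    also have "x * r ^ i = \<psi> i r"
      using D[of r] by (simp add: \<psi>_def Pr)
    also have "\<psi> i \<rho> + (\<Sum>j<N. \<rho> ^ (i + j) / D \<rho> * h j) - \<psi> i r =
        (\<Sum>j<N. \<rho> ^ (i + j) / D \<rho> * h j) + s i \<rho> * (\<rho> - r)"
      using s(1)[of i \<rho>] by simp
    also have "\<rho> - r = - (\<Sum>j<N. h j * crit N j \<rho>) / e1 \<rho>"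
    proof -
      have "e1 \<rho> * (\<rho> - r) = - (\<Sum>j<N. h j * crit N j \<rho>)"
        using crit0 e1(1)[of \<rho>] er by (simp add: e_def distrib_right sum.distrib)
      then show ?thesis
        using g by (simp add: field_simps)
    qed
    also have "(\<Sum>j<N. \<rho> ^ (i + j) / D \<rho> * h j) + s i \<rho> * (- (\<Sum>j<N. h j * crit N j \<rho>) / e1 \<rho>)
      = (\<Sum>j<N. \<Gamma> i j \<rho> * h j)"
      unfolding \<Gamma>_def left_diff_distrib sum_subtractf
      by (simp add: sum_divide_distrib sum_distrib_left sum_negf[symmetric] mult_ac)
    finally show ?thesis .
  qed
  have "has_jac N ?f u (\<lambda>i j. if i < N \<and> j < N then \<Gamma> i j r else 0)"
  proof (rule has_jac_caratheodory[OF \<Gamma>_cont])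
    fix \<eta> :: real assume "\<eta> > 0"
    obtain \<eta>0 where \<eta>0: "\<eta>0 > 0" "\<And>\<rho>. \<bar>\<rho> - r\<bar> < \<eta>0 \<Longrightarrow> Pr' \<rho>"
      using ev(2) by (auto simp: eventually_nhds_metric dist_real_def)
    obtain d1 where d1: "d1 > 0" "\<And>t. 0 < t \<Longrightarrow> t < d1 \<Longrightarrow> e (r - t) < 0"
      using DERIV_pos_inc_left[OF e_deriv e'(2)] er by auto
    obtain d2 where d2: "d2 > 0" "\<And>t. 0 < t \<Longrightarrow> t < d2 \<Longrightarrow> 0 < e (r + t)"
      using DERIV_pos_inc_right[OF e_deriv e'(2)] er by auto
    \<comment> \<open>The critical function changes sign between \<open>r - t\<close> and
      \<open>r + t\<close>. Small \<open>h\<close> preserve both signs, so the intermediate value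
      theorem supplies \<rho>.\<close>
    define t where "t = min (min \<eta> \<eta>0) (min d1 d2) / 2"
    have t: "0 < t" "t < \<eta>" "t < \<eta>0" "t < d1" "t < d2"
      using \<open>\<eta> > 0\<close> \<eta>0(1) d1(1) d2(1) by (auto simp: t_def)
    define eh where "eh = (\<lambda>h \<rho>. \<Sum>j<N. (u j + h j) * crit N j \<rho>)"
    have "((\<lambda>h. eh h \<rho>) \<longlongrightarrow> (\<Sum>j<N. (u j + 0) * crit N j \<rho>)) (small_vectors N)" for \<rho>
      unfolding eh_def by (intro tendsto_intros tendsto_small_vectors) auto
    then have eh_lim: "((\<lambda>h. eh h \<rho>) \<longlongrightarrow> e \<rho>) (small_vectors N)" for \<rho>
      by (simp add: e_def)
    have "\<forall>\<^sub>F h in small_vectors N. Ph h \<and> eh h (r - t) < 0 \<and> 0 < eh h (r + t)"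
      using order_tendstoD(2)[OF eh_lim d1(2)[OF t(1,4)]]
        order_tendstoD(1)[OF eh_lim d2(2)[OF t(1,5)]] ev(1)
      by eventually_elim auto
    then show "\<forall>\<^sub>F h in small_vectors N. \<exists>\<rho>. \<bar>\<rho> - r\<bar> < \<eta> \<and>
        (\<forall>i<N. ?f (vadd u h) i - ?f u i = (\<Sum>j<N. \<Gamma> i j \<rho> * h j))"
    proof eventually_elim
      fix h assume h: "Ph h \<and> eh h (r - t) < 0 \<and> 0 < eh h (r + t)"
      have "continuous_on {r - t..r + t} (eh h)"
        unfolding eh_def using isCont_crit
        by (intro continuous_intros continuous_at_imp_continuous_on ballI) auto
      then obtain \<rho> where \<rho>: "r - t \<le> \<rho>" "\<rho> \<le> r + t" "eh h \<rho> = 0"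
        using IVT'[of "eh h" "r - t" 0 "r + t"] h t(1) by auto
      then have "Pr' \<rho>" "\<bar>\<rho> - r\<bar> < \<eta>"
        using t by (auto intro!: \<eta>0(2))
      then show "\<exists>\<rho>. \<bar>\<rho> - r\<bar> < \<eta> \<and>
        (\<forall>i<N. ?f (vadd u h) i - ?f u i = (\<Sum>j<N. \<Gamma> i j \<rho> * h j))"
        using incr[of h \<rho>] h \<rho>(3) unfolding eh_def by blast
    qed
  qed
  then show "has_jac N ?f u (\<lambda>i j. if i < N \<and> j < N then r ^ (i + j) / sq_sum N r
        - (pow1 i r * x - r ^ i * x * cross_sum N r / sq_sum N r) * crit N j r / e' else 0)"
    unfolding \<Gamma>_def s(3) e1(3) \<psi>'_def D_def .
  show "?f u = ray N x r" by (fact fu)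
  show "(\<Sum>j<N. u j * r ^ j) = x * sq_sum N r"
    using Pr by (simp add: P_def D_def)
  show "(\<Sum>j<N. u j * crit N j r) = 0"
    using er by (simp add: e_def)
qed

section \<open>The polynomial \<open>X^n\<close> minus its tangent, and limits as \<open>r\<close>
  tends to 0\<close>

definition tangent :: "nat \<Rightarrow> real \<Rightarrow> nat \<Rightarrow> real" where
  "tangent q r j = (if j = 0 then real q * r ^ Suc q else if j = 1 then - real (Suc q) * r ^ q
      else if j = Suc q then 1 else 0)"

lemma sum_tangent:
  assumes "1 \<le> q"
  shows "(\<Sum>j<Suc (Suc q). tangent q r j * c j) =
    real q * r ^ Suc q * c 0 - real (Suc q) * r ^ q * c 1 + c (Suc q)"
proof -
  have "(\<Sum>j<Suc (Suc q). tangent q r j * c j) = (\<Sum>j<Suc (Suc q).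
     (if j = 0 then real q * r ^ Suc q * c 0 else 0) + (if j = 1 then - real (Suc q) * r ^ q * c 1 else 0)
     + (if j = Suc q then c (Suc q) else 0))"
    using assms by (intro sum.cong) (auto simp: tangent_def)
  also have "\<dots> = real q * r ^ Suc q * c 0 - real (Suc q) * r ^ q * c 1 + c (Suc q)"
    unfolding sum.distrib by (subst sum.delta, simp)+ (simp add: algebra_simps)
  finally show ?thesis .
qed

text \<open>Truncated subtraction kills the terms of degree 0 and 1, so only the leading coefficient
  contributes.\<close>

lemma quot_tangent:
  assumes "a < q"
  shows "quot (Suc (Suc q)) (tangent q r) r (a + 2) = real (q - a) * r ^ (q - 1 - a)"
  using assms sum_tangent[of q r "\<lambda>j. real (Suc j - (a + 2)) * r ^ (j - (a + 2))"]
  unfolding quot_def by (simp add: mult_ac del: sum.lessThan_Suc)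

definition pow1_sq_sum :: "nat \<Rightarrow> real \<Rightarrow> real" where
  "pow1_sq_sum N \<rho> = (\<Sum>i<N. pow1 i \<rho> * pow1 i \<rho>)"

text \<open>The terms with \<open><d'', d>\<close> cancel, which leaves the Gram determinant of
  \<open>d\<close> and \<open>d'\<close>.\<close>

lemma sum_power_crit':
  "(\<Sum>j<N. r ^ j * crit' N j r) = sq_sum N r * pow1_sq_sum N r - (cross_sum N r)\<^sup>2"
proof -
  define T where "T = (\<Sum>j<N. pow2 j r * r ^ j)"
  have "(\<Sum>j<N. r ^ j * crit' N j r) =
      sq_sum N r * cross_sum' N r - cross_sum N r * cross_sum N r - T * sq_sum N r"
    unfolding crit'_def T_def right_diff_distrib sum_subtractf
    by (simp add: sq_sum_def[of N r] cross_sum_def[of N r] sum_distrib_right sum_distrib_left mult_ac)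
  moreover have "cross_sum' N r = T + pow1_sq_sum N r"
    by (simp add: cross_sum'_def T_def pow1_sq_sum_def sum.distrib)
  ultimately show ?thesis
    by (simp add: algebra_simps power2_eq_square)
qed

text \<open>Value and derivative vanish at the double root, so only the second derivative
  \<open>(q + 1) q r^(q-1)\<close> survives.\<close>

lemma sum_tangent_crit':
  assumes "2 \<le> q"
  shows "(\<Sum>j<Suc (Suc q). tangent q r j * crit' N j r) =
    - (real (Suc q) * real q * r ^ (q - 1) * sq_sum N r)"
proof -
  obtain k where "q = Suc k"
    using assms by (cases q) auto
  then show ?thesis
    using assms by (subst sum_tangent) (auto simp: crit'_def pow1_def pow2_def algebra_simps)
qed

text \<open>At the point \<open>u\<close> with \<open>x = r^(q-1)\<close>, the \<open>\<rho>\<close>-derivative of the critical equation is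
  \<open>r^(q-1) * jac_denom q r\<close>, and the entry of the Jacobian at row \<open>1\<close>, column \<open>q + 1\<close> is
  \<open>r^q * jac_entry q r\<close>.\<close>
definition jac_denom :: "nat \<Rightarrow> real \<Rightarrow> real" where
  "jac_denom q r = sq_sum (Suc (Suc q)) r * pow1_sq_sum (Suc (Suc q)) r - (cross_sum (Suc (Suc q)) r)\<^sup>2
      + real (Suc q) * real q * sq_sum (Suc (Suc q)) r"

definition jac_entry :: "nat \<Rightarrow> real \<Rightarrow> real" where
  "jac_entry q r = r\<^sup>2 / sq_sum (Suc (Suc q)) r
      + (1 - r * cross_sum (Suc (Suc q)) r / sq_sum (Suc (Suc q)) r)
      * (real (Suc q) * sq_sum (Suc (Suc q)) r - r * cross_sum (Suc (Suc q)) r) / jac_denom q r"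

text \<open>At 0 the vectors \<open>d\<close> and \<open>d'\<close> are the unit vectors
  \<open>e_0\<close> and \<open>e_1\<close>.\<close>

lemma values_at_0:
  "sq_sum (Suc (Suc q)) 0 = 1" "cross_sum (Suc (Suc q)) 0 = 0" "pow1_sq_sum (Suc (Suc q)) 0 = 1"
proof -
  show "sq_sum (Suc (Suc q)) 0 = 1"
    unfolding sq_sum_def by (subst sum.lessThan_Suc_shift) simp
  have "pow1 i 0 * 0 ^ i = 0" for i
    by (cases i) (auto simp: pow1_def)
  then show "cross_sum (Suc (Suc q)) 0 = 0"
    unfolding cross_sum_def by (intro sum.neutral ballI)
  have "pow1 (Suc (Suc i)) 0 = 0" for i
    by (simp add: pow1_def)
  then show "pow1_sq_sum (Suc (Suc q)) 0 = 1"
    unfolding pow1_sq_sum_def by (simp add: sum.lessThan_Suc_shift pow1_def del: sum.lessThan_Suc)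
qed

lemma tendsto_jac_denom: "(jac_denom q \<longlongrightarrow> 1 + real (Suc q) * real q) (at_right 0)"
  and tendsto_jac_entry:
    "(jac_entry q \<longlongrightarrow> real (Suc q) / (1 + real (Suc q) * real q)) (at_right 0)"
proof -
  let ?N = "Suc (Suc q)"
  have D: "(sq_sum ?N \<longlongrightarrow> 1) (at_right 0)"
    using isCont_sq_sum[where N = ?N and \<rho> = 0]
    by (simp add: isCont_def values_at_0 filterlim_at_split)
  have Q: "(cross_sum ?N \<longlongrightarrow> 0) (at_right 0)"
    using DERIV_isCont[OF DERIV_cross_sum[where N = ?N and \<rho> = 0]]
    by (simp add: isCont_def values_at_0 filterlim_at_split)
  have "isCont (pow1_sq_sum ?N) 0"
    unfolding pow1_sq_sum_def[abs_def] pow1_def by (intro continuous_intros)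
  then have R: "(pow1_sq_sum ?N \<longlongrightarrow> 1) (at_right 0)"
    by (simp add: isCont_def values_at_0 filterlim_at_split)
  have "(jac_denom q \<longlongrightarrow> 1 * 1 - 0\<^sup>2 + real (Suc q) * real q * 1) (at_right 0)"
    unfolding jac_denom_def[abs_def] by (intro tendsto_intros D Q R)
  then show G: "(jac_denom q \<longlongrightarrow> 1 + real (Suc q) * real q) (at_right 0)"
    by simp
  have nz: "1 + real (Suc q) * real q \<noteq> 0"
    by (simp add: add_pos_nonneg less_imp_neq[symmetric] del: of_nat_Suc)
  have "(jac_entry q \<longlongrightarrow> 0\<^sup>2 / 1 + (1 - 0 * 0 / 1) * (real (Suc q) * 1 - 0 * 0)
      / (1 + real (Suc q) * real q)) (at_right 0)"
    unfolding jac_entry_def[abs_def] using nz by (intro tendsto_intros D Q R G) auto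
  then show "(jac_entry q \<longlongrightarrow> real (Suc q) / (1 + real (Suc q) * real q)) (at_right 0)"
    by simp
qed

section \<open>The linearization error near the negative unit vector\<close>

lemma semismooth_error:
  assumes q: "2 \<le> q" and N: "N = Suc (Suc q)" and r: "0 < r" "r \<le> 1" and pos: "0 < jac_denom q r"
    and u0: "u0 = (\<lambda>j. if j = Suc q then -1 else 0)"
  obtains h J where "h \<in> Rn N" "vnorm N h \<le> real N * (real N * r ^ (q - 1))"
    "J \<in> clarke_jac N (proj N (hankel_cone q)) (vadd u0 h)"
    "r ^ q * jac_entry q r \<le> vnorm N (vsub (vsub (proj N (hankel_cone q) (vadd u0 h))
        (proj N (hankel_cone q) u0)) (mv N J h))"
proof -
  let ?f = "proj N (hankel_cone q)"
  \<comment> \<open>With this \<open>x\<close>, both parts of \<open>e'\<close> have order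
    \<open>r^(q-1)\<close>, and \<open>e'\<close> is \<open>x\<close> times a quantity with a
    positive limit.\<close>
  define x where "x = r ^ (q - 1)"
  define u where "u = (\<lambda>j. if j < N then x * r ^ j - tangent q r j else 0)"
  define h where "h = vsub u u0"
  define e' where "e' = (\<Sum>j<N. u j * crit' N j r)"
  define D where "D = sq_sum N r"
  define Q where "Q = cross_sum N r"
  define J where "J = (\<lambda>i j. if i < N \<and> j < N then r ^ (i + j) / D
        - (pow1 i r * x - r ^ i * x * Q / D) * crit N j r / e' else 0)"
  have x: "0 < x"
    using r by (simp add: x_def)
  have D: "0 < D"
    unfolding D_def N by (rule sq_sum_pos)
  have rq: "r ^ q = r * x" "r ^ Suc q = r * r * x"
    using q by (cases q; simp add: x_def)+
  have "e' = x * (\<Sum>j<N. r ^ j * crit' N j r) - (\<Sum>j<N. tangent q r j * crit' N j r)"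
    unfolding e'_def sum_distrib_left sum_subtractf[symmetric]
    by (intro sum.cong) (auto simp: u_def algebra_simps)
  also have "\<dots> = x * jac_denom q r"
    unfolding sum_power_crit' using sum_tangent_crit'[OF q, of r N]
    unfolding N[symmetric] jac_denom_def x_def by (simp add: algebra_simps)
  finally have e'_eq: "e' = x * jac_denom q r" .
  have root: "(\<Sum>j<N. tangent q r j * r ^ j) = 0"
    unfolding N using q by (subst sum_tangent) (auto simp: algebra_simps)
  have root': "(\<Sum>j<N. tangent q r j * pow1 j r) = 0"
    unfolding N using q by (subst sum_tangent) (auto simp: algebra_simps pow1_def)
  have quot: "0 < quot N (tangent q r) r (a + 2)" if "a < q" for a
    unfolding N quot_tangent[OF that] using that r by simp
  note jac = has_jac_proj_hankel_cone[OF N x r(1) _ root root' quot e'_def]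
  have u_eq: "u j = x * r ^ j - tangent q r j" if "j < N" for j
    using that by (simp add: u_def)
  have e'_pos: "0 < e'"
    using x pos by (simp add: e'_eq)
  have hj: "has_jac N ?f u J"
    unfolding J_def D_def Q_def by (rule jac(1)[OF u_eq _ e'_pos])
  have fu: "?f u = ray N x r"
    by (rule jac(2)[OF u_eq _ e'_pos])
  have Pu: "(\<Sum>j<N. u j * r ^ j) = x * D"
    unfolding D_def by (rule jac(3)[OF u_eq _ e'_pos])
  have eu: "(\<Sum>j<N. u j * crit N j r) = 0"
    by (rule jac(4)[OF u_eq _ e'_pos])
  \<comment> \<open>The point \<open>u0\<close> has the data \<open>x = 0\<close>,
    \<open>r = 0\<close> and residual \<open>X^(q+1)\<close>, whose double root at 0 leaves the
    quotient \<open>X^(q-1)\<close>.\<close>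
  have fu0: "?f u0 = ray N 0 0"
  proof (rule proj_hankel_cone[where q = q, folded N])
    fix j
    show "u0 j = 0 * 0 ^ j - (if j = Suc q then 1 else 0)"
      by (simp add: u0)
  next
    show "(\<Sum>j<N. (if j = Suc q then 1 else 0) * 0 ^ j) = (0::real)"
      by (intro sum.neutral) auto
    show "(\<Sum>j<N. (if j = Suc q then 1 else 0) * (real j * 0 ^ (j - 1))) = 0"
      using q by (intro sum.neutral) auto
    show "0 \<le> quot N (\<lambda>j. if j = Suc q then 1 else 0) 0 (a + 2)" for a
      unfolding quot_def by (intro sum_nonneg) auto
  qed auto
  have uh: "vadd u0 h = u"
    by (auto simp: vadd_def h_def vsub_def)
  have "u \<in> Rn N" "u0 \<in> Rn N"
    by (auto simp: u_def u0 N Rn_def)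
  then have hR: "h \<in> Rn N"
    by (auto simp: h_def vsub_def Rn_def)
  \<comment> \<open>As \<open>u\<close> is itself a point of differentiability, a constant sequence
    and a single convex weight suffice.\<close>
  have "J \<in> bjac N ?f u"
    unfolding bjac_def using hj \<open>u \<in> Rn N\<close>
    by (auto intro!: exI[of _ "\<lambda>_. u"] exI[of _ "\<lambda>_. J"] simp: vsub_def vnorm_def)
  then have clarke: "J \<in> clarke_jac N ?f (vadd u0 h)"
    unfolding uh clarke_jac_def
    by (auto intro!: exI[of _ 1] exI[of _ "\<lambda>_. 1"] exI[of _ "\<lambda>_. J"])
  \<comment> \<open>The unit entry of \<open>tangent\<close> at \<open>q + 1\<close> cancels against
    \<open>u0\<close>; everything left carries the factor \<open>x\<close>.\<close>
  have h_le: "\<bar>h j\<bar> \<le> real N * x" if "j < N" for j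
  proof -
    have le1: "r ^ k \<le> 1" for k
      using r by (simp add: power_le_one)
    have xr: "0 \<le> x * r ^ k" "x * r ^ k \<le> x" for k
      using x r le1[of k] by (auto simp: mult_left_le)
    consider "j = 0" | "j = 1" | "2 \<le> j"
      by linarith
    then show ?thesis
    proof cases
      case 1
      have "h j = x - real q * (x * r ^ 2)"
        using 1 by (simp add: h_def vsub_def u_def u0 N tangent_def rq power2_eq_square mult_ac)
      moreover have "0 \<le> real q * (x * r ^ 2)" "real q * (x * r ^ 2) \<le> real q * x"
        using xr[of 2] by (auto intro: mult_left_mono)
      moreover have "real N * x = real q * x + 2 * x"
        by (simp add: N algebra_simps)
      moreover have "0 \<le> real q * x"
        using x by simp
      ultimately show ?thesis
        using x by linarith
    next
      case 2
      have "h j = real N * (x * r ^ 1)"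
        using 2 q by (simp add: h_def vsub_def u_def u0 N tangent_def rq algebra_simps)
      then show ?thesis
        using xr[of 1] by (simp add: abs_mult mult_left_mono)
    next
      case 3
      then have "h j = x * r ^ j"
        using that by (auto simp: h_def vsub_def u_def u0 N tangent_def)
      moreover have "1 * x \<le> real N * x"
        using x by (intro mult_right_mono) (auto simp: N)
      ultimately show ?thesis
        using xr[of j] by simp
    qed
  qed
  have "vnorm N h \<le> (\<Sum>j<N. real N * x)"
    using h_le by (intro order_trans[OF vnorm_le_sum_abs] sum_mono) auto
  then have h_norm: "vnorm N h \<le> real N * (real N * r ^ (q - 1))"
    by (simp add: x_def)
  have "mv N J h 1 = (\<Sum>j<N. J 1 j * u j) - (\<Sum>j<N. J 1 j * u0 j)"
    by (simp add: mv_def N h_def vsub_def right_diff_distrib sum_subtractf)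
  also have "(\<Sum>j<N. J 1 j * u0 j) = (\<Sum>j<N. if j = Suc q then - J 1 j else 0)"
    by (intro sum.cong) (auto simp: u0)
  also have "\<dots> = - J 1 (Suc q)"
    by (simp add: N)
  \<comment> \<open>Row 1 of Euler's identity \<open>J u = f(u)\<close>: the \<open>crit\<close>
    part vanishes on \<open>u\<close>.\<close>
  also have "(\<Sum>j<N. J 1 j * u j) =
      r / D * (\<Sum>j<N. u j * r ^ j) - (pow1 1 r * x - r * x * Q / D) / e' * (\<Sum>j<N. u j * crit N j r)"
    unfolding sum_distrib_left sum_subtractf[symmetric]
    by (intro sum.cong) (auto simp: J_def N algebra_simps)
  also have "\<dots> = x * r"
    using D by (simp add: Pu eu)
  finally have "vsub (vsub (?f (vadd u0 h)) (?f u0)) (mv N J h) 1 = - J 1 (Suc q)"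
    unfolding vsub_def uh fu fu0 by (simp add: ray_def N)
  moreover have "J 1 (Suc q) = r ^ q * jac_entry q r"
  proof -
    have "crit N (Suc q) r = - (r * x * (real (Suc q) * D - r * Q))"
      unfolding crit_def D_def Q_def pow1_def using rq by (simp add: algebra_simps)
    moreover have "J 1 (Suc q) = r * (r * r * x) / D
        - (x - r * x * Q / D) * crit N (Suc q) r / (x * jac_denom q r)"
      using N by (simp add: J_def e'_eq rq(2)[simplified] pow1_def)
    ultimately have "J 1 (Suc q) = r * (r * r * x) / D
        - (x - r * x * Q / D) * (- (r * x * (real (Suc q) * D - r * Q))) / (x * jac_denom q r)"
      by simp
    also have "x - r * x * Q / D = x * (1 - r * Q / D)"
      by (simp add: right_diff_distrib mult_ac)
    also have "r * (r * r * x) / D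
        - x * (1 - r * Q / D) * (- (r * x * (real (Suc q) * D - r * Q))) / (x * jac_denom q r)
      = r * (r * r * x) / D
        + x * (1 - r * Q / D) * (r * x * (real (Suc q) * D - r * Q)) / (x * jac_denom q r)"
      by simp
    also have "\<dots> = r * x * jac_entry q r"
      unfolding jac_entry_def N[symmetric] D_def[symmetric] Q_def[symmetric]
      using x by (simp add: distrib_left power2_eq_square mult_ac)
    finally show ?thesis
      by (simp add: rq)
  qed
  ultimately have "r ^ q * jac_entry q r \<le> vnorm N (vsub (vsub (?f (vadd u0 h)) (?f u0)) (mv N J h))"
    using abs_le_vnorm[of 1 N "vsub (vsub (?f (vadd u0 h)) (?f u0)) (mv N J h)"] by (simp add: N)
  with hR h_norm clarke show ?thesis
    by (rule that)
qed

section \<open>Comparison of orders in \<open>r\<close>\<close>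

lemma not_semismooth_proj_hankel_cone:
  assumes q: "2 \<le> q" and p: "1 < real (q - 1) * p" "0 < p"
  shows "\<not> semismooth (Suc (Suc q)) p (proj (Suc (Suc q)) (hankel_cone q))
    (\<lambda>j. if j = Suc q then -1 else 0)"
proof
  define N where "N = Suc (Suc q)"
  define f where "f = proj N (hankel_cone q)"
  define u0 where "u0 = (\<lambda>j. if j = Suc q then -1 else (0::real))"
  assume "semismooth (Suc (Suc q)) p (proj (Suc (Suc q)) (hankel_cone q))
    (\<lambda>j. if j = Suc q then -1 else 0)"
  then obtain C \<delta> where "0 < \<delta>" and C: "\<And>h W. h \<in> Rn N \<Longrightarrow> vnorm N h < \<delta> \<Longrightarrow>
      W \<in> clarke_jac N f (vadd u0 h) \<Longrightarrow>
      vnorm N (vsub (vsub (f (vadd u0 h)) (f u0)) (mv N W h)) \<le> C * vnorm N h powr (1 + p)"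
    unfolding semismooth_def N_def f_def u0_def by blast
  define B where "B = real N * real N"
  \<comment> \<open>The assumed bound has order \<open>r^((q-1)(1+p)) = r^(q+s)\<close>, the error
    has order \<open>r^q\<close>; the hypothesis on \<open>p\<close> says that \<open>s\<close> is
    positive.\<close>
  define s where "s = real (q - 1) * (1 + p) - real q"
  have s: "0 < s"
    using p q by (simp add: s_def of_nat_diff distrib_left)
  have l: "0 < real (Suc q) / (1 + real (Suc q) * real q)"
    by (intro divide_pos_pos add_pos_nonneg) auto
  obtain c where c: "0 < c" "c < real (Suc q) / (1 + real (Suc q) * real q)"
    using dense[OF l] by blast
  have "((\<lambda>r. B * r ^ (q - 1)) \<longlongrightarrow> B * 0 ^ (q - 1)) (at_right 0)"
    by (intro tendsto_intros)
  then have 1: "\<forall>\<^sub>F r in at_right 0. B * r ^ (q - 1) < \<delta>"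
    by (rule order_tendstoD(2)) (use q \<open>0 < \<delta>\<close> in \<open>auto simp: power_0_left\<close>)
  have "((\<lambda>r. r powr s) \<longlongrightarrow> 0) (at_right 0)"
    using s by (intro tendsto_zero_powrI[where b = s] tendsto_intros)
      (auto simp: eventually_at_right_less intro: eventually_at_right_less[THEN eventually_mono])
  then have "((\<lambda>r. \<bar>C\<bar> * B powr (1 + p) * r powr s) \<longlongrightarrow> \<bar>C\<bar> * B powr (1 + p) * 0) (at_right 0)"
    by (intro tendsto_intros)
  then have 2: "\<forall>\<^sub>F r in at_right 0. \<bar>C\<bar> * B powr (1 + p) * r powr s < c"
    using c(1) by (intro order_tendstoD(2)) auto
  have 3: "\<forall>\<^sub>F r in at_right 0. c < jac_entry q r"
    by (rule order_tendstoD(1)[OF tendsto_jac_entry c(2)])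
  have 4: "\<forall>\<^sub>F r in at_right 0. 0 < jac_denom q r"
    by (rule order_tendstoD(1)[OF tendsto_jac_denom]) (auto intro: add_pos_nonneg)
  have 5: "\<forall>\<^sub>F r in at_right (0::real). 0 < r \<and> r \<le> 1"
    unfolding eventually_at_right_field by (auto intro!: exI[of _ 1])
  have "\<forall>\<^sub>F r in at_right (0::real). False"
    using 1 2 3 4 5
  proof eventually_elim
    case (elim r)
    then have r: "0 < r" "r \<le> 1"
      by auto
    obtain h J where h: "h \<in> Rn N" "vnorm N h \<le> real N * (real N * r ^ (q - 1))"
      and J: "J \<in> clarke_jac N f (vadd u0 h)"
      and err: "r ^ q * jac_entry q r \<le> vnorm N (vsub (vsub (f (vadd u0 h)) (f u0)) (mv N J h))"
      using semismooth_error[OF q N_def r elim(4) u0_def] unfolding f_def by blast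
    have hB: "vnorm N h \<le> B * r ^ (q - 1)"
      using h(2) by (simp add: B_def)
    have "r ^ q * c < r ^ q * jac_entry q r"
      using elim(3) r by simp
    also note err
    also have "vnorm N (vsub (vsub (f (vadd u0 h)) (f u0)) (mv N J h)) \<le> C * vnorm N h powr (1 + p)"
      using hB elim(1) by (intro C h(1) J) auto
    \<comment> \<open>The sign of \<open>C\<close> is unknown, so its absolute value is taken before
      the norm of \<open>h\<close> is enlarged.\<close>
    also have "\<dots> \<le> \<bar>C\<bar> * (B * r ^ (q - 1)) powr (1 + p)"
      using hB p by (intro mult_mono powr_mono2 vnorm_nonneg) auto
    also have "(B * r ^ (q - 1)) powr (1 + p) = B powr (1 + p) * r powr (real (q - 1) * (1 + p))"
      using r by (simp add: powr_mult B_def powr_powr powr_realpow[symmetric])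
    also have "r powr (real (q - 1) * (1 + p)) = r ^ q * r powr s"
      using r by (simp add: s_def powr_realpow[symmetric] powr_add[symmetric])
    finally have "r ^ q * c < r ^ q * (\<bar>C\<bar> * B powr (1 + p) * r powr s)"
      by (simp add: mult_ac)
    then show False
      using elim(2) r by simp
  qed
  then show False
    by simp
qed

theorem theorem1:
  fixes p :: real
  assumes "p > 0"
  shows "\<exists>(N::nat) (m::nat) (A::nat \<Rightarrow> nat \<Rightarrow> nat \<Rightarrow> real).
           0 < N \<and> 0 < m \<and> (\<forall>k\<le>N. sym_mat m (A k)) \<and>
           spectrahedron N m A \<noteq> {} \<and>
           (\<exists>x\<in>Rn N. \<not> semismooth N p (proj N (spectrahedron N m A)) x)"
proof -
  obtain k :: nat where k: "1 / p < real k"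
    using reals_Archimedean2 by blast
  \<comment> \<open>This gives both \<open>2 \<le> q\<close> and
    \<open>q - 1 > 1 / p\<close>.\<close>
  define q where "q = k + 2"
  have "1 / p < real (q - 1)"
    using k by (simp add: q_def)
  then have "1 < real (q - 1) * p"
    using assms by (simp only: pos_divide_less_eq)
  then have "\<not> semismooth (Suc (Suc q)) p (proj (Suc (Suc q)) (hankel_cone q))
      (\<lambda>j. if j = Suc q then -1 else 0)"
    using assms by (intro not_semismooth_proj_hankel_cone) (auto simp: q_def)
  moreover have "(\<lambda>j. if j = Suc q then -1 else 0) \<in> Rn (Suc (Suc q))"
    by (auto simp: Rn_def)
  moreover have "hankel_cone q \<noteq> {}"
    using ray_in_hankel_cone[of 0 0 q] by auto
  ultimately show ?thesis
    unfolding hankel_cone_def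
    by (intro exI[of _ "Suc (Suc q)"] exI[of _ "2 * q"] exI[of _ hankel_blocks])
      (auto simp: sym_hankel_blocks q_def)
qed

end
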